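(* Let $\mathcal{L}\in\mathscr{H}(d)$ satisfy $\mathcal{L}(I_d)=0$ and $\mathrm{tr}(\mathcal{L}(X))=0$ for all $X\in M_d$. The following are equivalent: (i) $e^{t\mathcal{L}}$ is a mixed unitary channel for every $t\ge0$; (ii) $\mathcal{L}$ belongs to the closed convex cone generated by $\{\mathrm{Ad}_U-\mathrm{id}:U\in\mathbb{U}(d)\}$; (iii) $\langle\Gamma,\mathcal{L}\rangle\ge0$ for all $\Gamma\in\mathscr{D}(d)$.
   Context: $\mathrm{Ad}_U(X)=U^*XU$; $\mathbb{U}(d)$ is the unitary group of $M_d$. A mixed unitary channel is a map $\sum_{j=1}^\ell\lambda_j\mathrm{Ad}_{U_j}$ with $U_j\in\mathbb{U}(d)$, $\lambda_j\ge0$, $\sum_j\lambda_j=1$. $\mathscr{H}(d)$ is the real vector space of Hermitian-preserving linear maps on $M_d$. Choi matrix $\mathscr{J}(\Phi)=(\mathrm{id}\otimes\Phi)(|\Omega_d\rangle\langle\Omega_d|)$, $\Omega_d=d^{-1/2}\sum_j e_j\otimes e_j$; inner product $\langle\Phi,\Psi\rangle=\mathrm{tr}(\mathscr{J}(\Phi)^*\mathscr{J}(\Psi))$. $\mathscr{W}(d)$ is the set of unital, trace-preserving elements of $\mathscr{H}(d)$, and $\mathscr{D}(d)=\{\Gamma\in\mathscr{W}(d):\langle\mathrm{id},\Gamma\rangle=0,\ \langle\mathrm{Ad}_U,\Gamma\rangle\ge0\ \forall U\in\mathbb{U}(d)\}$. *)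

theory Defs
  imports "HOL-Analysis.Analysis"
begin

type_synonym 'n mat = "complex^'n^'n"

definition cadj :: "'n::finite mat \<Rightarrow> 'n mat" where
  "cadj X = (\<chi> i j. cnj (X $ j $ i))"

definition hermitian :: "'n::finite mat \<Rightarrow> bool" where
  "hermitian X \<longleftrightarrow> cadj X = X"

definition unitary :: "'n::finite mat \<Rightarrow> bool" where
  "unitary U \<longleftrightarrow> cadj U ** U = mat 1"

definition cscale :: "complex \<Rightarrow> 'n::finite mat \<Rightarrow> 'n mat" where
  "cscale c X = (\<chi> i j. c * X $ i $ j)"

definition munit :: "'n::finite \<Rightarrow> 'n \<Rightarrow> 'n mat" where
  "munit i j = (\<chi> a b. if a = i \<and> b = j then 1 else 0)"

definition Ad :: "'n::finite mat \<Rightarrow> ('n mat \<Rightarrow>\<^sub>L 'n mat)" where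
  "Ad U = Blinfun (\<lambda>X. cadj U ** X ** U)"

text \<open>H(d): complex-linear Hermitian-preserving maps on M_d
  (linear maps are represented as bounded real-linear maps, plus complex homogeneity).\<close>
definition herm_pres :: "('n::finite mat \<Rightarrow>\<^sub>L 'n mat) \<Rightarrow> bool" where
  "herm_pres \<Phi> \<longleftrightarrow> (\<forall>c X. blinfun_apply \<Phi> (cscale c X) = cscale c (blinfun_apply \<Phi> X))
     \<and> (\<forall>X. hermitian X \<longrightarrow> hermitian (blinfun_apply \<Phi> X))"

text \<open>Choi matrix J(Phi) = (id \<otimes> Phi)(|Omega_d><Omega_d|) = (1/d) sum_ij E_ij \<otimes> Phi(E_ij),
  as a matrix indexed by 'n \<times> 'n (Kronecker index ordering).\<close>
definition choi :: "('n::finite mat \<Rightarrow>\<^sub>L 'n mat) \<Rightarrow> complex^('n \<times> 'n)^('n \<times> 'n)" where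
  "choi \<Phi> = (\<chi> p q. (1 / of_nat CARD('n)) * blinfun_apply \<Phi> (munit (fst p) (fst q)) $ snd p $ snd q)"

definition cadj2 :: "complex^('m::finite)^'m \<Rightarrow> complex^'m^'m" where
  "cadj2 X = (\<chi> i j. cnj (X $ j $ i))"

definition hs_inner :: "('n::finite mat \<Rightarrow>\<^sub>L 'n mat) \<Rightarrow> ('n mat \<Rightarrow>\<^sub>L 'n mat) \<Rightarrow> complex" where
  "hs_inner \<Phi> \<Psi> = trace (cadj2 (choi \<Phi>) ** choi \<Psi>)"

definition Wset :: "('n::finite mat \<Rightarrow>\<^sub>L 'n mat) set" where
  "Wset = {\<Gamma>. herm_pres \<Gamma> \<and> blinfun_apply \<Gamma> (mat 1) = mat 1
              \<and> (\<forall>X. trace (blinfun_apply \<Gamma> X) = trace X)}"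

definition Dset :: "('n::finite mat \<Rightarrow>\<^sub>L 'n mat) set" where
  "Dset = {\<Gamma>. \<Gamma> \<in> Wset \<and> hs_inner id_blinfun \<Gamma> = 0
              \<and> (\<forall>U. unitary U \<longrightarrow> Re (hs_inner (Ad U) \<Gamma>) \<ge> 0)}"

definition mixed_unitary :: "('n::finite mat \<Rightarrow> 'n mat) \<Rightarrow> bool" where
  "mixed_unitary \<Phi> \<longleftrightarrow> (\<exists>(l::nat) (lam::nat \<Rightarrow> real) U.
      (\<forall>j<l. 0 \<le> lam j \<and> unitary (U j)) \<and> (\<Sum>j<l. lam j) = 1 \<and>
      (\<forall>X. \<Phi> X = (\<Sum>j<l. lam j *\<^sub>R (cadj (U j) ** X ** U j))))"

definition map_exp :: "real \<Rightarrow> ('n::finite mat \<Rightarrow>\<^sub>L 'n mat) \<Rightarrow> 'n mat \<Rightarrow> 'n mat" where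
  "map_exp t L X = (\<Sum>k. (t ^ k / fact k) *\<^sub>R ((blinfun_apply L ^^ k) X))"

definition unitary_cone :: "('n::finite mat \<Rightarrow>\<^sub>L 'n mat) set" where
  "unitary_cone = (\<lambda>S. convex_cone S \<and> closed S) hull {Ad U - id_blinfun | U. unitary U}"

end

theory Submission
  imports Defs
begin

text \<open>The convex hull of the maps \<open>Ad U\<close> is compact and closed under composition. If every
  \<open>exp (t L)\<close> lies in it, then the difference quotients of \<open>exp (t L)\<close> at \<open>0\<close> lie in the cone
  and tend to \<open>L\<close>. Conversely, if \<open>c\<^sub>k (m\<^sub>k - id)\<close> tends to \<open>L\<close> with \<open>m\<^sub>k\<close> in the hull, then
  \<open>exp (t L)\<close> is the limit of \<open>(id + (t/N\<^sub>k) c\<^sub>k (m\<^sub>k - id))^N\<^sub>k\<close> as soon as \<open>N\<^sub>k \<rightarrow> \<infinity>\<close>, and for \<open>N\<^sub>k \<ge> t c\<^sub>k\<close>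
  these powers lie in the hull.

  If \<open>L\<close> is outside the cone, separate it, and project the separating functional orthogonally onto
  the direction space of the affine space \<open>Wset\<close>, which yields \<open>\<Gamma>\<^sub>1\<close>. The completely depolarizing map
  \<open>\<Omega>\<close> is a mixture of unitary conjugations, so \<open>\<langle>\<Gamma>\<^sub>1, id\<rangle> \<le> \<langle>\<Gamma>\<^sub>1, \<Omega>\<rangle> = 0\<close>. Adding a small multiple of
  \<open>\<Omega> - id\<close> makes this inequality strict, giving \<open>\<Gamma>\<^sub>2\<close>, and \<open>\<Omega> + r \<Gamma>\<^sub>2\<close> with the \<open>r > 0\<close> that
  makes it orthogonal to \<open>id\<close> is an element of \<open>Dset\<close> violating the inequality in the third condition.\<close>

section \<open>Limits of powers and exponentials\<close>

text \<open>Tannery's theorem. The Weierstrass M-test makes the partial sums converge uniformly in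
  \<open>n\<close>, and a uniform limit may be exchanged with the limit
  \<open>n \<rightarrow> \<infinity>\<close>.\<close>

lemma tendsto_suminf_dominated:
  fixes f :: "nat \<Rightarrow> nat \<Rightarrow> 'a::banach"
  assumes lim: "\<And>k. (\<lambda>n. f k n) \<longlonglongrightarrow> g k"
    and bound: "\<And>k n. norm (f k n) \<le> M k"
    and "summable M"
  shows "(\<lambda>n. \<Sum>k. f k n) \<longlonglongrightarrow> (\<Sum>k. g k)"
proof -
  have unif: "uniform_limit UNIV (\<lambda>N n. \<Sum>k<N. f k n) (\<lambda>n. \<Sum>k. f k n) sequentially"
    by (rule Weierstrass_m_test) (use bound \<open>summable M\<close> in auto)
  have g_le: "norm (g k) \<le> M k" for k
    by (rule tendsto_upperbound[OF tendsto_norm[OF lim[of k]]]) (use bound in auto)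
  have "(\<lambda>N. \<Sum>k<N. g k) \<longlonglongrightarrow> (\<Sum>k. g k)"
    by (rule summable_LIMSEQ, rule summable_comparison_test'[OF \<open>summable M\<close>]) (use g_le in auto)
  then show ?thesis
    by (rule swap_uniform_limit'[rotated])
      (use unif lim in \<open>auto intro!: tendsto_sum always_eventually\<close>)
qed

lemma blinfun_funpow_le:
  fixes f :: "'a::real_normed_vector \<Rightarrow>\<^sub>L 'a"
  shows   "norm ((blinfun_apply f ^^ k) x) \<le> norm f ^ k * norm x"
proof (induction k)
  case (Suc k)
  have "norm ((blinfun_apply f ^^ Suc k) x) \<le> norm f * norm ((blinfun_apply f ^^ k) x)"
    by (simp add: norm_blinfun)
  also have "\<dots> \<le> norm f * (norm f ^ k * norm x)"
    by (intro mult_left_mono Suc) simp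
  finally show ?case by simp
qed simp

lemma tendsto_blinfun_funpow:
  fixes g :: "'a::real_normed_vector \<Rightarrow>\<^sub>L 'a"
  assumes "f \<longlonglongrightarrow> g"
  shows "(\<lambda>n. (blinfun_apply (f n) ^^ k) x) \<longlonglongrightarrow> (blinfun_apply g ^^ k) x"
  by (induction k) (simp_all add: blinfun.tendsto assms)

text \<open>Binomial theorem for the commuting maps identity and \<open>a *\<^sub>R f\<close>,
  written along the orbit of a single vector so that it matches the series in
  \<open>map_exp\<close>.\<close>

lemma funpow_id_add_scaleR:
  fixes f :: "'a::real_normed_vector \<Rightarrow>\<^sub>L 'a"
  shows "(blinfun_apply (id_blinfun + a *\<^sub>R f) ^^ n) x
    = (\<Sum>k\<le>n. (real (n choose k) * a ^ k) *\<^sub>R (blinfun_apply f ^^ k) x)"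
proof (induction n)
  case (Suc n)
  let ?t = "\<lambda>n k. (real (n choose k) * a ^ k) *\<^sub>R (blinfun_apply f ^^ k) x"
  have "(blinfun_apply (id_blinfun + a *\<^sub>R f) ^^ Suc n) x = (\<Sum>k\<le>n. ?t n k) + a *\<^sub>R blinfun_apply f (\<Sum>k\<le>n. ?t n k)"
    by (simp add: Suc blinfun.add_left blinfun.scaleR_left)
  also have "a *\<^sub>R blinfun_apply f (\<Sum>k\<le>n. ?t n k)
      = (\<Sum>k\<le>n. (real (n choose k) * a ^ Suc k) *\<^sub>R (blinfun_apply f ^^ Suc k) x)"
    by (simp add: blinfun.sum_right blinfun.scaleR_right scaleR_sum_right mult_ac)
  \<comment> \<open>The added top term is zero. After the constant term is split off, both sums run
    over the same range and Pascal's rule combines them.\<close>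
  also have "(\<Sum>k\<le>n. ?t n k) = (\<Sum>k\<le>Suc n. ?t n k)"
    by (simp add: binomial_eq_0)
  also have "\<dots> = x + (\<Sum>k\<le>n. ?t n (Suc k))"
    by (subst sum.atMost_Suc_shift) simp
  also have "\<dots> + (\<Sum>k\<le>n. (real (n choose k) * a ^ Suc k) *\<^sub>R (blinfun_apply f ^^ Suc k) x)
      = x + (\<Sum>k\<le>n. ?t (Suc n) (Suc k))"
    by (simp add: sum.distrib scaleR_add_left distrib_right add_ac del: funpow.simps power_Suc)
  also have "\<dots> = (\<Sum>k\<le>Suc n. ?t (Suc n) k)"
    by (subst sum.atMost_Suc_shift) simp
  finally show ?case .
qed simp

lemma binomial_div_power_le: "real (n choose k) / real n ^ k \<le> 1 / fact k"
proof (cases "n = 0")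
  case True
  then show ?thesis by (cases k) auto
next
  case False
  have "real ((n choose k) * fact k) \<le> real (n ^ k)"
    by (rule of_nat_mono) (rule binomial_fact_pow)
  then show ?thesis
    using False by (simp add: field_simps)
qed

text \<open>Induction through \<open>(k + 1) * (n choose (k + 1)) = (n - k) * (n choose k)\<close>:
  each step contributes the factor \<open>(n - k) / n\<close>, which tends to 1, and the divisor
  \<open>k + 1\<close>.\<close>

lemma binomial_div_power_tendsto: "(\<lambda>n. real (n choose k) / real n ^ k) \<longlonglongrightarrow> 1 / fact k"
proof (induction k)
  case 0
  then show ?case by simp
next
  case (Suc k)
  have "(\<lambda>n. real (n choose k) / real n ^ k * ((real n - real k) / real n) / real (Suc k)) \<longlonglongrightarrow> 1 / fact k * 1 / real (Suc k)"
  proof (intro Suc tendsto_divide tendsto_mult tendsto_const)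
    have "(\<lambda>n. 1 - real k * (1 / real n)) \<longlonglongrightarrow> 1 - real k * 0"
      by (intro tendsto_intros lim_1_over_n)
    moreover have "\<forall>\<^sub>F n in sequentially. 1 - real k * (1 / real n) = (real n - real k) / real n"
      using eventually_gt_at_top[of 0] by eventually_elim (simp add: field_simps)
    ultimately show "(\<lambda>n. (real n - real k) / real n) \<longlonglongrightarrow> 1"
      by (simp add: filterlim_cong)
  qed simp
  moreover have "real (n choose k) / real n ^ k * ((real n - real k) / real n) / real (Suc k)
      = real (n choose Suc k) / real n ^ Suc k" for n
  proof -
    have "real (Suc k) * real (n choose Suc k) = (real n - real k) * real (n choose k)"
    \<comment> \<open>For \<open>k > n\<close> natural subtraction would truncate, but then both
      binomial coefficients vanish.\<close>
    proof (cases "k \<le> n")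
      case True
      have "Suc k * (n choose Suc k) = (n - k) * (n choose k)"
        using binomial_absorb_comp[of n k] binomial_absorption[of k n] by (metis binomial_absorption binomial_absorb_comp)
      then show ?thesis using True by (metis of_nat_diff of_nat_mult)
    qed (simp add: binomial_eq_0)
    then show ?thesis
      by (simp add: divide_simps del: of_nat_Suc) (simp add: algebra_simps)
  qed
  ultimately show ?case by (simp add: mult.commute)
qed

text \<open>Euler's limit with a generator that varies along the sequence. In the binomial expansion
  the \<open>j\<close>-th coefficient tends to \<open>t ^ j / fact j\<close>, and a common bound
  \<open>B\<close> of the norms gives the summable majorant
  \<open>(\<bar>t\<bar> * B) ^ j / fact j * norm X\<close>.\<close>

lemma tendsto_map_exp:
  assumes L: "Lk \<longlonglongrightarrow> L" and N: "filterlim N at_top sequentially"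
  shows "(\<lambda>k. (blinfun_apply (id_blinfun + (t / real (N k)) *\<^sub>R Lk k) ^^ N k) X) \<longlonglongrightarrow> map_exp t L X"
proof -
  obtain B where B: "\<And>k. norm (Lk k) \<le> B"
    using convergent_imp_Bseq[OF convergentI[OF L]] by (auto simp: Bseq_def)
  define f where "f j k = (real (N k choose j) * (t / real (N k)) ^ j) *\<^sub>R (blinfun_apply (Lk k) ^^ j) X" for j k
  have f_eq: "f j k = (t ^ j * (real (N k choose j) / real (N k) ^ j)) *\<^sub>R (blinfun_apply (Lk k) ^^ j) X" for j k
    by (simp add: f_def power_divide mult_ac)
  have "(\<lambda>k. \<Sum>j. f j k) \<longlonglongrightarrow> (\<Sum>j. (t ^ j * (1 / fact j)) *\<^sub>R (blinfun_apply L ^^ j) X)"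
  proof (rule tendsto_suminf_dominated)
    show "(\<lambda>k. f j k) \<longlonglongrightarrow> (t ^ j * (1 / fact j)) *\<^sub>R (blinfun_apply L ^^ j) X" for j
      unfolding f_eq
      by (intro tendsto_intros tendsto_blinfun_funpow L filterlim_compose[OF binomial_div_power_tendsto N])
    show "norm (f j k) \<le> (\<bar>t\<bar> * B) ^ j /\<^sub>R fact j * norm X" for j k
    proof -
      have "norm ((blinfun_apply (Lk k) ^^ j) X) \<le> norm (Lk k) ^ j * norm X"
        by (rule blinfun_funpow_le)
      also have "\<dots> \<le> B ^ j * norm X"
        by (intro mult_right_mono power_mono B) auto
      finally have "norm ((blinfun_apply (Lk k) ^^ j) X) \<le> B ^ j * norm X" .
      then have "norm (f j k) \<le> (\<bar>t\<bar> ^ j * (1 / fact j)) * (B ^ j * norm X)"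
        unfolding f_eq norm_scaleR abs_mult power_abs
        by (intro mult_mono) (auto simp: binomial_div_power_le)
      then show ?thesis
        by (simp add: power_mult_distrib field_simps)
    qed
    show "summable (\<lambda>j. (\<bar>t\<bar> * B) ^ j /\<^sub>R fact j * norm X)"
      by (intro summable_mult2 summable_exp_generic)
  qed
  moreover have "(\<Sum>j. f j k) = (blinfun_apply (id_blinfun + (t / real (N k)) *\<^sub>R Lk k) ^^ N k) X" for k
    unfolding funpow_id_add_scaleR f_def
    by (rule suminf_finite) (auto simp: binomial_eq_0)
  ultimately show ?thesis
    by (simp add: map_exp_def)
qed

lemma summable_map_exp:
  fixes L :: "'a::banach \<Rightarrow>\<^sub>L 'a"
  shows "summable (\<lambda>k. (t ^ k / fact k) *\<^sub>R (blinfun_apply L ^^ k) X)"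
proof (rule summable_comparison_test')
  show "summable (\<lambda>k. (\<bar>t\<bar> * norm L) ^ k /\<^sub>R fact k * norm X)"
    by (intro summable_mult2 summable_exp_generic)
  show "norm ((t ^ k / fact k) *\<^sub>R (blinfun_apply L ^^ k) X) \<le> (\<bar>t\<bar> * norm L) ^ k /\<^sub>R fact k * norm X" for k
  proof -
    have "norm ((t ^ k / fact k) *\<^sub>R (blinfun_apply L ^^ k) X) = \<bar>t\<bar> ^ k / fact k * norm ((blinfun_apply L ^^ k) X)"
      by (simp add: power_abs)
    also have "\<dots> \<le> \<bar>t\<bar> ^ k / fact k * (norm L ^ k * norm X)"
      by (intro mult_left_mono blinfun_funpow_le) auto
    finally show ?thesis by (simp add: power_mult_distrib divide_inverse mult_ac)
  qed
qed

text \<open>With \<open>s = 1 / Suc n\<close>, dividing by \<open>s\<close> lowers each power of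
  \<open>s\<close> by one, so in the limit only the linear term of the series survives.\<close>

lemma map_exp_derivative_at_0:
  "(\<lambda>n. real (Suc n) *\<^sub>R (map_exp (1 / real (Suc n)) L X - X)) \<longlonglongrightarrow> blinfun_apply L X"
proof -
  define f where "f j n = ((1 / real (Suc n)) ^ j / fact (Suc j)) *\<^sub>R (blinfun_apply L ^^ Suc j) X" for j n
  define g where "g j = (if j = 0 then blinfun_apply L X else 0)" for j :: nat
  have "(\<lambda>n. \<Sum>j. f j n) \<longlonglongrightarrow> (\<Sum>j. g j)"
  proof (rule tendsto_suminf_dominated)
    have inv: "(\<lambda>n. 1 / real (Suc n)) \<longlonglongrightarrow> 0"
      using LIMSEQ_inverse_real_of_nat by (simp add: divide_inverse)
    show "(\<lambda>n. f j n) \<longlonglongrightarrow> g j" for j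
    proof -
      \<comment> \<open>Since \<open>0 ^ 0 = 1\<close>, this limit is \<open>L X\<close> for
        \<open>j = 0\<close> and zero for every other \<open>j\<close>.\<close>
      have "(\<lambda>n. f j n) \<longlonglongrightarrow> (0 ^ j / fact (Suc j)) *\<^sub>R (blinfun_apply L ^^ Suc j) X"
        unfolding f_def by (intro tendsto_intros inv) simp
      then show ?thesis by (cases j) (simp_all add: g_def)
    qed
    show "norm (f j n) \<le> norm L ^ j /\<^sub>R fact j * (norm L * norm X)" for j n
    proof -
      have "(1 / real (Suc n)) ^ j / fact (Suc j) \<le> 1 / fact j"
        by (intro frac_le power_le_one fact_mono) auto
      then have "norm (f j n) \<le> 1 / fact j * (norm L ^ Suc j * norm X)"
        unfolding f_def norm_scaleR
        by (intro mult_mono blinfun_funpow_le) auto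
      then show ?thesis by (simp add: field_simps)
    qed
    show "summable (\<lambda>j. norm L ^ j /\<^sub>R fact j * (norm L * norm X))"
      by (intro summable_mult2 summable_exp_generic)
  qed
  moreover have "(\<Sum>j. g j) = blinfun_apply L X"
    by (subst suminf_finite[of "{0}"]) (simp_all add: g_def)
  moreover have "(\<Sum>j. f j n) = real (Suc n) *\<^sub>R (map_exp (1 / real (Suc n)) L X - X)" for n
  proof -
    define s where "s = 1 / real (Suc n)"
    let ?c = "\<lambda>j. (s ^ j / fact j) *\<^sub>R (blinfun_apply L ^^ j) X"
    have summ: "summable (\<lambda>j. ?c (Suc j))"
      by (rule iffD2[OF summable_Suc_iff summable_map_exp])
    have "map_exp s L X - X = (\<Sum>j. ?c (Suc j))"
      using suminf_split_head[OF summable_map_exp[of s L X]]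
      by (simp add: map_exp_def del: funpow.simps fact_Suc)
    then have "real (Suc n) *\<^sub>R (map_exp s L X - X) = (\<Sum>j. real (Suc n) *\<^sub>R ?c (Suc j))"
      by (simp only: suminf_scaleR_right[OF summ])
    also have "\<dots> = (\<Sum>j. f j n)"
    proof (rule arg_cong[where f = suminf], rule ext)
      fix j
      have "real (Suc n) * (s ^ Suc j / fact (Suc j)) = s ^ j / fact (Suc j)"
        by (simp add: s_def del: fact_Suc of_nat_Suc)
      then show "real (Suc n) *\<^sub>R ((s ^ Suc j / fact (Suc j)) *\<^sub>R (blinfun_apply L ^^ Suc j) X) = f j n"
        unfolding f_def s_def[symmetric] scaleR_scaleR by (rule arg_cong)
    qed
    finally show ?thesis
      unfolding s_def by (rule sym)
  qed
  ultimately show ?thesis by (simp only:)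
qed

section \<open>Unitary conjugations and their mixtures\<close>

lemma cadj_nth [simp]: "cadj X $ i $ j = cnj (X $ j $ i)"
  by (simp add: cadj_def)

lemma cscale_nth [simp]: "cscale c X $ i $ j = c * X $ i $ j"
  by (simp add: cscale_def)

lemma munit_nth [simp]: "munit i j $ a $ b = (if a = i \<and> b = j then 1 else 0)"
  by (simp add: munit_def)

lemma cadj_matrix_mul: "cadj (A ** B) = cadj B ** cadj A"
  by (simp add: vec_eq_iff matrix_matrix_mult_def mult.commute)

lemma cadj_cadj [simp]: "cadj (cadj X) = X"
  by (simp add: vec_eq_iff)

lemma cadj_add: "cadj (X + Y) = cadj X + cadj Y"
  by (simp add: vec_eq_iff)

lemma cadj_scaleR: "cadj (r *\<^sub>R X) = r *\<^sub>R cadj X"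
  by (simp add: vec_eq_iff)

lemma cadj_mat_1 [simp]: "cadj (mat 1) = mat 1"
  by (simp add: vec_eq_iff mat_def)

lemma cscale_add: "cscale c (X + Y) = cscale c X + cscale c Y"
  by (simp add: vec_eq_iff algebra_simps)

lemma cscale_scaleR: "cscale c (r *\<^sub>R X) = r *\<^sub>R cscale c X"
  by (simp add: vec_eq_iff)

lemma trace_scaleR: "trace (r *\<^sub>R X) = r *\<^sub>R trace (X :: 'n::finite mat)"
  by (simp add: trace_def scaleR_sum_right)

lemma unitary_mat_1: "unitary (mat 1)"
  by (simp add: unitary_def)

text \<open>The definition of \<open>unitary\<close> asks for a left inverse; for square matrices it
  is also a right inverse.\<close>

lemma unitary_mult_cadj: "unitary U \<Longrightarrow> U ** cadj U = mat 1"
  unfolding unitary_def by (subst matrix_left_right_inverse)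

lemma unitary_matrix_mul: "unitary U \<Longrightarrow> unitary V \<Longrightarrow> unitary (U ** V)"
  unfolding unitary_def cadj_matrix_mul
  by (metis matrix_mul_assoc matrix_mul_rid)

lemma bounded_linear_sandwich:
  fixes A B :: "'n::finite mat"
  shows "bounded_linear (\<lambda>X. A ** X ** B)"
  unfolding linear_conv_bounded_linear[symmetric]
  by (rule linearI)
    (simp_all add: vec_eq_iff matrix_matrix_mult_def sum.distrib distrib_left distrib_right scaleR_sum_right[symmetric])

lemma Ad_apply: "blinfun_apply (Ad U) X = cadj U ** X ** U"
  by (simp add: Ad_def bounded_linear_Blinfun_apply bounded_linear_sandwich)

lemma Ad_nth: "blinfun_apply (Ad U) X $ k $ l = (\<Sum>b\<in>UNIV. \<Sum>a\<in>UNIV. cnj (U $ a $ k) * X $ a $ b * U $ b $ l)"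
  by (simp add: Ad_apply matrix_matrix_mult_def sum_distrib_right)

lemma Ad_mat_1: "Ad (mat 1) = id_blinfun"
  by (rule blinfun_eqI) (simp add: Ad_apply)

lemma Ad_compose: "Ad U o\<^sub>L Ad V = Ad (V ** U)"
  by (rule blinfun_eqI) (simp add: Ad_apply cadj_matrix_mul matrix_mul_assoc)

text \<open>The differences of elements of \<open>Wset\<close> lie here, and the hypotheses of the
  theorem say exactly that \<open>L\<close> does.\<close>

definition Wset_direction :: "('n::finite mat \<Rightarrow>\<^sub>L 'n mat) set" where
  "Wset_direction = {\<Phi>. herm_pres \<Phi> \<and> blinfun_apply \<Phi> (mat 1) = 0 \<and> (\<forall>X. trace (blinfun_apply \<Phi> X) = 0)}"

lemma herm_pres_id: "herm_pres id_blinfun"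
  by (simp add: herm_pres_def)

lemma herm_pres_add: "herm_pres \<Phi> \<Longrightarrow> herm_pres \<Psi> \<Longrightarrow> herm_pres (\<Phi> + \<Psi>)"
  by (simp add: herm_pres_def hermitian_def blinfun.add_left cscale_add cadj_add)

lemma herm_pres_scaleR: "herm_pres \<Phi> \<Longrightarrow> herm_pres (r *\<^sub>R \<Phi>)"
  by (simp add: herm_pres_def hermitian_def blinfun.scaleR_left cscale_scaleR cadj_scaleR)

lemma herm_pres_Ad: "herm_pres (Ad U)"
  unfolding herm_pres_def hermitian_def
proof (intro conjI allI impI)
  show "blinfun_apply (Ad U) (cscale c X) = cscale c (blinfun_apply (Ad U) X)" for c X
    by (simp add: vec_eq_iff Ad_nth sum_distrib_left mult_ac)
  show "cadj (blinfun_apply (Ad U) X) = blinfun_apply (Ad U) X" if "cadj X = X" for X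
    by (simp add: Ad_apply cadj_matrix_mul that matrix_mul_assoc)
qed

lemma subspace_Wset_direction: "subspace Wset_direction"
  unfolding subspace_def Wset_direction_def
  by (auto simp: herm_pres_add herm_pres_scaleR blinfun.add_left blinfun.scaleR_left trace_add trace_scaleR)
    (simp add: herm_pres_def hermitian_def vec_eq_iff trace_def)+

lemma Ad_diff_id_in_Wset_direction:
  assumes "unitary U"
  shows "Ad U - id_blinfun \<in> Wset_direction"
proof -
  have "herm_pres (Ad U + (- 1) *\<^sub>R id_blinfun)"
    by (intro herm_pres_add herm_pres_scaleR herm_pres_Ad herm_pres_id)
  \<comment> \<open>Cyclicity of the trace brings \<open>U ** cadj U\<close> together.\<close>
  moreover have "trace (cadj U ** X ** U) = trace X" for X
    by (subst trace_mul_sym) (simp add: matrix_mul_assoc unitary_mult_cadj assms)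
  ultimately show ?thesis
    using assms by (simp add: Wset_direction_def Ad_apply blinfun.diff_left trace_sub unitary_def)
qed

text \<open>These are the mixed unitary channels, taken as bounded linear maps so that convexity and
  compactness can be used.\<close>

definition unitary_mix :: "('n::finite mat \<Rightarrow>\<^sub>L 'n mat) set" where
  "unitary_mix = convex hull {Ad U | U. unitary U}"

lemma convex_unitary_mix: "convex unitary_mix"
  by (simp add: unitary_mix_def)

lemma Ad_in_unitary_mix: "unitary U \<Longrightarrow> Ad U \<in> unitary_mix"
  unfolding unitary_mix_def by (rule hull_inc) auto

lemma id_in_unitary_mix: "id_blinfun \<in> unitary_mix"
  using Ad_in_unitary_mix[OF unitary_mat_1] by (simp add: Ad_mat_1)

text \<open>Reduces a convex property of \<open>m - id_blinfun\<close> to the generators: the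
  translate of \<open>S\<close> by the identity is convex and contains every \<open>Ad U\<close>,
  hence the hull.\<close>

lemma unitary_mix_diff_id:
  assumes "convex S" and Ad: "\<And>U. unitary U \<Longrightarrow> Ad U - id_blinfun \<in> S" and "m \<in> unitary_mix"
  shows "m - id_blinfun \<in> S"
proof -
  have "{Ad U | U. unitary U} \<subseteq> (+) id_blinfun ` S"
  proof clarify
    fix U :: "'a mat"
    assume "unitary U"
    then show "Ad U \<in> (+) id_blinfun ` S"
      by (intro image_eqI[OF _ Ad]) simp_all
  qed
  then have "convex hull {Ad U | U. unitary U} \<subseteq> (+) id_blinfun ` S"
    by (rule hull_minimal) (rule convex_translation[OF assms(1)])
  with assms(3) have "m \<in> (+) id_blinfun ` S"
    unfolding unitary_mix_def by (rule set_rev_mp)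
  then show ?thesis
    by (elim imageE) simp
qed

text \<open>Composition is linear in each factor. The left factor is extended from conjugations to
  the hull with the right one fixed at \<open>Ad V\<close>; then the right factor is
  extended.\<close>

lemma unitary_mix_compose:
  assumes "m \<in> unitary_mix" "m' \<in> unitary_mix"
  shows "m o\<^sub>L m' \<in> unitary_mix"
proof -
  have lin1: "linear (\<lambda>f. f o\<^sub>L g)" and lin2: "linear (\<lambda>f. g o\<^sub>L f)" for g :: "'a mat \<Rightarrow>\<^sub>L 'a mat"
    by (auto intro!: linearI blinfun_eqI simp: blinfun.add_left blinfun.scaleR_left blinfun.add_right blinfun.scaleR_right)
  have "m o\<^sub>L Ad V \<in> unitary_mix" if "unitary V" for V
  proof -
    have "convex ((\<lambda>f. f o\<^sub>L Ad V) -` unitary_mix)"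
      by (rule convex_linear_vimage[OF lin1 convex_unitary_mix])
    moreover have "{Ad U | U. unitary U} \<subseteq> (\<lambda>f. f o\<^sub>L Ad V) -` unitary_mix"
      using that by (auto simp: Ad_compose intro!: Ad_in_unitary_mix unitary_matrix_mul)
    ultimately show ?thesis
      using hull_minimal assms(1) unfolding unitary_mix_def by fast
  qed
  then have "{Ad U | U. unitary U} \<subseteq> (\<lambda>f. m o\<^sub>L f) -` unitary_mix"
    by auto
  moreover have "convex ((\<lambda>f. m o\<^sub>L f) -` unitary_mix)"
    by (rule convex_linear_vimage[OF lin2 convex_unitary_mix])
  ultimately show ?thesis
    using hull_minimal assms(2) unfolding unitary_mix_def by fast
qed

lemma mixed_unitary_iff: "mixed_unitary \<Phi> \<longleftrightarrow> (\<exists>m\<in>unitary_mix. \<Phi> = blinfun_apply m)"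
proof
  assume "mixed_unitary \<Phi>"
  then show "\<exists>m\<in>unitary_mix. \<Phi> = blinfun_apply m"
    unfolding mixed_unitary_def
  proof (elim exE conjE)
    fix l :: nat and lam :: "nat \<Rightarrow> real" and U
    assume *: "\<forall>j<l. 0 \<le> lam j \<and> unitary (U j)" "(\<Sum>j<l. lam j) = 1"
      and \<Phi>: "\<forall>X. \<Phi> X = (\<Sum>j<l. lam j *\<^sub>R (cadj (U j) ** X ** U j))"
    have "(\<Sum>j<l. lam j *\<^sub>R Ad (U j)) \<in> unitary_mix"
      by (rule convex_sum) (use * in \<open>auto simp: convex_unitary_mix Ad_in_unitary_mix\<close>)
    moreover have "\<Phi> = blinfun_apply (\<Sum>j<l. lam j *\<^sub>R Ad (U j))"
      by (simp add: fun_eq_iff \<Phi> blinfun.sum_left blinfun.scaleR_left Ad_apply)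
    ultimately show ?thesis by (rule rev_bexI)
  qed
next
  assume "\<exists>m\<in>unitary_mix. \<Phi> = blinfun_apply m"
  then obtain S u where S: "finite S" "S \<subseteq> {Ad U | U. unitary U}" "\<forall>x\<in>S. 0 \<le> u x" "sum u S = 1"
    and \<Phi>: "\<Phi> = blinfun_apply (\<Sum>v\<in>S. u v *\<^sub>R v)"
    unfolding unitary_mix_def convex_hull_explicit by blast
  \<comment> \<open>The hull is described by weights on a finite set of maps; enumerating that set
    gives the family indexed by natural numbers that \<open>mixed_unitary\<close> asks for.\<close>
  obtain h where h: "bij_betw h {..<card S} S"
    using ex_bij_betw_nat_finite[OF S(1)] by (auto simp: atLeast0LessThan)
  have "\<forall>v\<in>S. \<exists>U. unitary U \<and> v = Ad U"
    using S(2) by blast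
  then obtain W where W: "\<And>v. v \<in> S \<Longrightarrow> unitary (W v) \<and> v = Ad (W v)"
    by metis
  have hS: "h j \<in> S" if "j < card S" for j
    using h that by (auto dest: bij_betwE)
  show "mixed_unitary \<Phi>"
    unfolding mixed_unitary_def
  proof (intro exI[of _ "card S"] exI[of _ "u \<circ> h"] exI[of _ "W \<circ> h"] conjI allI impI)
    show "(\<Sum>j<card S. (u \<circ> h) j) = 1"
      using sum.reindex_bij_betw[OF h, of u] S(4) by simp
    fix X
    have "\<Phi> X = (\<Sum>v\<in>S. u v *\<^sub>R blinfun_apply v X)"
      by (simp add: \<Phi> blinfun.sum_left blinfun.scaleR_left)
    also have "\<dots> = (\<Sum>j<card S. u (h j) *\<^sub>R blinfun_apply (h j) X)"
      by (rule sum.reindex_bij_betw[OF h, symmetric])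
    also have "\<dots> = (\<Sum>j<card S. (u \<circ> h) j *\<^sub>R (cadj ((W \<circ> h) j) ** X ** (W \<circ> h) j))"
      by (rule sum.cong) (use hS W Ad_apply in \<open>metis comp_apply lessThan_iff\<close>)+
    finally show "\<Phi> X = (\<Sum>j<card S. (u \<circ> h) j *\<^sub>R (cadj ((W \<circ> h) j) ** X ** (W \<circ> h) j))" .
  qed (use hS S(3) W in auto)
qed

section \<open>The Choi isomorphism\<close>

lemma choi_nth: "choi \<Phi> $ (i, k) $ (j, l) = blinfun_apply \<Phi> (munit i j) $ k $ l / of_nat CARD('n)"
  for \<Phi> :: "'n::finite mat \<Rightarrow>\<^sub>L 'n mat"
  by (simp add: choi_def)

lemma linear_choi: "linear choi"
  by (rule linearI) (simp_all add: vec_eq_iff choi_def blinfun.add_left blinfun.scaleR_left algebra_simps)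

lemma continuous_on_choi: "continuous_on UNIV choi"
  unfolding choi_def by (intro continuous_intros)

lemma inner_eq_trace_cadj2: "X \<bullet> Y = Re (trace (cadj2 X ** Y))"
proof -
  have "X \<bullet> Y = (\<Sum>i\<in>UNIV. \<Sum>j\<in>UNIV. Re (cnj (X $ i $ j) * Y $ i $ j))"
    by (simp add: inner_vec_def inner_complex_def)
  also have "\<dots> = Re (trace (cadj2 X ** Y))"
    by (subst sum.swap) (simp add: trace_def matrix_matrix_mult_def cadj2_def)
  finally show ?thesis .
qed

text \<open>Moves the pairing into the Euclidean space of Choi matrices, where separation and
  orthogonal projection take place.\<close>

lemma Re_hs_inner: "Re (hs_inner \<Phi> \<Psi>) = choi \<Phi> \<bullet> choi \<Psi>"
  by (simp add: hs_inner_def inner_eq_trace_cadj2)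

text \<open>Both \<open>X + cadj X\<close> and \<open>cscale \<i> (X - cadj X)\<close> are
  Hermitian, so their images are. By complex homogeneity this gives two entrywise equations, which
  together determine the image of \<open>cadj X\<close>.\<close>

lemma herm_pres_cadj:
  assumes "herm_pres \<Phi>"
  shows "blinfun_apply \<Phi> (cadj X) = cadj (blinfun_apply \<Phi> X)"
proof -
  have "hermitian (X + cadj X)" "hermitian (cscale \<i> (X - cadj X))"
    by (simp_all add: hermitian_def vec_eq_iff algebra_simps)
  then have "hermitian (blinfun_apply \<Phi> (X + cadj X))" "hermitian (blinfun_apply \<Phi> (cscale \<i> (X - cadj X)))"
    using assms unfolding herm_pres_def by blast+
  moreover have "blinfun_apply \<Phi> (cscale \<i> (X - cadj X)) = cscale \<i> (blinfun_apply \<Phi> (X - cadj X))"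
    using assms unfolding herm_pres_def by blast
  ultimately have *: "hermitian (blinfun_apply \<Phi> X + blinfun_apply \<Phi> (cadj X))"
      "hermitian (cscale \<i> (blinfun_apply \<Phi> X - blinfun_apply \<Phi> (cadj X)))"
    by (simp_all add: blinfun.add_right blinfun.diff_right)
  show ?thesis
    unfolding vec_eq_iff
  proof (intro allI)
    fix i j
    let ?a = "\<lambda>i j. blinfun_apply \<Phi> X $ i $ j" and ?b = "\<lambda>i j. blinfun_apply \<Phi> (cadj X) $ i $ j"
    have "cnj (?a j i) + cnj (?b j i) = ?a i j + ?b i j"
      "- \<i> * (cnj (?a j i) - cnj (?b j i)) = \<i> * (?a i j - ?b i j)"
      using * by (simp_all add: hermitian_def vec_eq_iff)
    then have "?b i j = cnj (?a j i)"
      by (simp add: complex_eq_iff)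
    then show "?b i j = cadj (blinfun_apply \<Phi> X) $ i $ j" by simp
  qed
qed

text \<open>Both Choi matrices are Hermitian, and the trace of a product of two Hermitian matrices
  is real. This upgrades the vanishing of the real part to the complex equation in
  \<open>Dset\<close>.\<close>

lemma Im_hs_inner:
  assumes "herm_pres \<Phi>" "herm_pres \<Psi>"
  shows "Im (hs_inner \<Phi> \<Psi>) = 0"
proof -
  have herm: "cnj (choi \<Theta> $ p $ q) = choi \<Theta> $ q $ p" if "herm_pres \<Theta>" for \<Theta> :: "'a mat \<Rightarrow>\<^sub>L 'a mat" and p q
  proof -
    have "munit (fst q) (fst p) = cadj (munit (fst p) (fst q) :: 'a mat)"
      by (auto simp: vec_eq_iff)
    then show ?thesis
      by (simp add: choi_def herm_pres_cadj[OF that])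
  qed
  have "cnj (hs_inner \<Phi> \<Psi>) = (\<Sum>q\<in>UNIV. \<Sum>p\<in>UNIV. choi \<Phi> $ p $ q * choi \<Psi> $ q $ p)"
    by (simp add: hs_inner_def trace_def matrix_matrix_mult_def cadj2_def herm assms)
  also have "\<dots> = (\<Sum>p\<in>UNIV. \<Sum>q\<in>UNIV. choi \<Phi> $ p $ q * choi \<Psi> $ q $ p)"
    by (rule sum.swap)
  also have "\<dots> = hs_inner \<Phi> \<Psi>"
    by (simp add: hs_inner_def trace_def matrix_matrix_mult_def cadj2_def herm assms)
  finally show ?thesis
    by (simp add: complex_eq_iff)
qed

lemma cmat_eq_sum_munit: "X = (\<Sum>i\<in>UNIV. \<Sum>j\<in>UNIV. cscale (X $ i $ j) (munit i j))"
proof -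
  have "(\<Sum>i\<in>UNIV. \<Sum>j\<in>UNIV. X $ i $ j * (if a = i \<and> b = j then 1 else 0)) = X $ a $ b" for a b
  proof -
    have "(\<Sum>i\<in>UNIV. \<Sum>j\<in>UNIV. X $ i $ j * (if a = i \<and> b = j then 1 else 0))
      = (\<Sum>i\<in>UNIV. if i = a then X $ i $ b else 0)"
      by (intro sum.cong refl) (auto simp: if_distrib sum.delta cong: if_cong)
    then show ?thesis by simp
  qed
  then show ?thesis
    by (simp add: vec_eq_iff)
qed

text \<open>The inverse Choi formula; the factor \<open>CARD('n)\<close> cancels the normalisation
  in \<open>choi\<close>.\<close>

definition unchoi :: "complex^('n \<times> 'n)^('n \<times> 'n) \<Rightarrow> ('n::finite mat \<Rightarrow>\<^sub>L 'n mat)" where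
  "unchoi J = Blinfun (\<lambda>X. \<chi> k l. of_nat CARD('n) * (\<Sum>i\<in>UNIV. \<Sum>j\<in>UNIV. X $ i $ j * J $ (i, k) $ (j, l)))"

lemma unchoi_apply:
  "blinfun_apply (unchoi J) X = (\<chi> k l. of_nat CARD('n) * (\<Sum>i\<in>UNIV. \<Sum>j\<in>UNIV. X $ i $ j * J $ (i, k) $ (j, l)))"
  for X :: "'n::finite mat"
proof -
  have "bounded_linear (\<lambda>X::'n mat. \<chi> k l. of_nat CARD('n) * (\<Sum>i\<in>UNIV. \<Sum>j\<in>UNIV. X $ i $ j * J $ (i, k) $ (j, l)))"
    unfolding linear_conv_bounded_linear[symmetric]
    by (rule linearI) (simp_all add: vec_eq_iff sum.distrib distrib_right distrib_left scaleR_sum_right[symmetric])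
  then show ?thesis
    by (simp add: unchoi_def bounded_linear_Blinfun_apply)
qed

lemma linear_unchoi: "linear unchoi"
  by (rule linearI; rule blinfun_eqI)
    (simp_all add: vec_eq_iff unchoi_apply blinfun.add_left blinfun.scaleR_left sum.distrib distrib_left scaleR_sum_right[symmetric])

text \<open>The Choi matrix records only the values on matrix units. The complex homogeneity
  contained in \<open>herm_pres\<close> makes these determine the map.\<close>

lemma unchoi_choi:
  fixes \<Phi> :: "'n::finite mat \<Rightarrow>\<^sub>L 'n mat"
  assumes "herm_pres \<Phi>"
  shows "unchoi (choi \<Phi>) = \<Phi>"
proof (rule blinfun_eqI)
  fix X :: "'n mat"
  have "blinfun_apply \<Phi> X = (\<Sum>i\<in>UNIV. \<Sum>j\<in>UNIV. cscale (X $ i $ j) (blinfun_apply \<Phi> (munit i j)))"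
    by (subst cmat_eq_sum_munit[of X]) (use assms in \<open>simp add: blinfun.sum_right herm_pres_def\<close>)
  then show "blinfun_apply (unchoi (choi \<Phi>)) X = blinfun_apply \<Phi> X"
    by (simp add: unchoi_apply choi_nth vec_eq_iff sum_distrib_left)
qed

section \<open>Compactness of the unitary group and of the mixed unitary channels\<close>

lemma compact_unitaries: "compact {U :: 'n::finite mat. unitary U}"
proof -
  \<comment> \<open>The unitary matrices lie on a sphere, since the squared norm is the trace of
    \<open>cadj U ** U\<close>.\<close>
  have "norm U = sqrt (real CARD('n))" if "unitary U" for U :: "'n mat"
  proof -
    have "cadj2 U = cadj U"
      by (simp add: cadj2_def cadj_def)
    then show ?thesis
      using that by (simp add: norm_eq_sqrt_inner inner_eq_trace_cadj2 unitary_def trace_I)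
  qed
  then have "bounded {U :: 'n mat. unitary U}"
    by (intro boundedI[of _ "sqrt (real CARD('n))"]) simp
  moreover have "closed {U :: 'n mat. unitary U}"
    unfolding unitary_def cadj_def matrix_matrix_mult_def
    by (intro closed_Collect_eq continuous_intros)
  ultimately show ?thesis
    by (simp add: compact_eq_bounded_closed)
qed

text \<open>The convex hull is formed in the Euclidean space of Choi matrices, where hulls of
  compact sets are compact, and is carried back by the continuous linear map
  \<open>unchoi\<close>.\<close>

lemma compact_unitary_mix: "compact (unitary_mix :: ('n::finite mat \<Rightarrow>\<^sub>L 'n mat) set)"
proof -
  let ?A = "{Ad U | U :: 'n mat. unitary U}"
  have "continuous_on {U :: 'n mat. unitary U} (\<lambda>U. choi (Ad U))"
    unfolding choi_def Ad_nth by (intro continuous_intros)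
  then have "compact ((\<lambda>U. choi (Ad U)) ` {U :: 'n mat. unitary U})"
    by (rule compact_continuous_image[OF _ compact_unitaries])
  also have "(\<lambda>U. choi (Ad U)) ` {U :: 'n mat. unitary U} = choi ` ?A"
    by auto
  finally have "compact (convex hull (choi ` ?A))"
    by (rule compact_convex_hull)
  moreover have "continuous_on (convex hull (choi ` ?A)) unchoi"
    by (rule linear_continuous_on) (rule linear_unchoi[unfolded linear_conv_bounded_linear])
  ultimately have "compact (unchoi ` (convex hull (choi ` ?A)))"
    by (rule compact_continuous_image[rotated])
  also have "unchoi ` (convex hull (choi ` ?A)) = convex hull (unchoi ` choi ` ?A)"
    by (rule convex_hull_linear_image[OF linear_unchoi])
  also have "unchoi ` choi ` ?A = ?A"
    unfolding image_image by (rule trans[OF image_cong image_ident]) (auto simp: unchoi_choi herm_pres_Ad)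
  finally show ?thesis
    by (simp add: unitary_mix_def)
qed

section \<open>The completely depolarizing map\<close>

text \<open>Precomposition with the transposition of \<open>k\<close> and \<open>k'\<close> permutes
  the bijections, so the sum over \<open>p\<close> does not depend on \<open>k\<close>. Summing over
  all \<open>k\<close> and exchanging the sums gives the value.\<close>

lemma sum_bij_apply:
  fixes f :: "'n::finite \<Rightarrow> complex"
  shows "of_nat CARD('n) * (\<Sum>p\<in>{p::'n \<Rightarrow> 'n. bij p}. f (p k)) = of_nat (card {p::'n \<Rightarrow> 'n. bij p}) * (\<Sum>a\<in>UNIV. f a)"
proof -
  have eq: "(\<Sum>p\<in>{p::'n \<Rightarrow> 'n. bij p}. f (p k)) = (\<Sum>p\<in>{p. bij p}. f (p k'))" for k' :: 'n
    by (rule sum.reindex_bij_witness[where i = "\<lambda>p. p \<circ> Transposition.transpose k k'" and j = "\<lambda>p. p \<circ> Transposition.transpose k k'"])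
      (auto simp: comp_assoc intro: bij_comp)
  have "(\<Sum>k'\<in>(UNIV::'n set). \<Sum>p\<in>{p::'n \<Rightarrow> 'n. bij p}. f (p k)) = (\<Sum>k'\<in>(UNIV::'n set). \<Sum>p\<in>{p. bij p}. f (p k'))"
    by (rule sum.cong[OF refl eq])
  also have "\<dots> = (\<Sum>p\<in>{p::'n \<Rightarrow> 'n. bij p}. \<Sum>k'\<in>UNIV. f (p k'))"
    by (rule sum.swap)
  also have "\<dots> = (\<Sum>p\<in>{p::'n \<Rightarrow> 'n. bij p}. \<Sum>a\<in>UNIV. f a)"
    by (intro sum.cong refl sum.reindex_bij_betw) auto
  finally show ?thesis by simp
qed

text \<open>A sign vector is encoded by the set of its negative positions, so averaging over signs
  is a sum over the finite type \<open>'n set\<close>.\<close>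

definition subset_sign :: "'n set \<Rightarrow> 'n \<Rightarrow> complex" where
  "subset_sign A i = (if i \<in> A then - 1 else 1)"

lemma sum_subset_sign:
  "(\<Sum>A\<in>UNIV. subset_sign A k * subset_sign A l) = (if k = l then 2 ^ CARD('n) else 0)"
  for k l :: "'n::finite"
proof (cases "k = l")
  case True
  have "subset_sign A k * subset_sign A k = 1" for A
    by (simp add: subset_sign_def)
  then show ?thesis using True by (simp add: card_Pow flip: Pow_UNIV)
next
  case False
  let ?S = "\<Sum>A\<in>UNIV. subset_sign A k * subset_sign A l"
  let ?flip = "\<lambda>A. if k \<in> A then A - {k} else insert k A"
  \<comment> \<open>Toggling membership of \<open>k\<close> is an involution on subsets; for
    \<open>k \<noteq> l\<close> it changes the sign of exactly one factor.\<close>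
  have "?S = (\<Sum>A\<in>UNIV. - (subset_sign A k * subset_sign A l))"
    by (rule sum.reindex_bij_witness[where i = ?flip and j = ?flip])
      (use False in \<open>auto simp: subset_sign_def\<close>)
  also have "\<dots> = - ?S"
    by (rule sum_negf)
  finally show ?thesis using False by simp
qed

definition signed_perm :: "'n set \<Rightarrow> ('n \<Rightarrow> 'n) \<Rightarrow> 'n::finite mat" where
  "signed_perm A p = (\<chi> a b. if a = p b then subset_sign A b else 0)"

lemma Ad_signed_perm_nth:
  "blinfun_apply (Ad (signed_perm A p)) X $ k $ l = subset_sign A k * subset_sign A l * X $ p k $ p l"
proof -
  have "blinfun_apply (Ad (signed_perm A p)) X $ k $ l
    = (\<Sum>b\<in>UNIV. if b = p l then (\<Sum>a\<in>UNIV. if a = p k then cnj (subset_sign A k) * X $ a $ b * subset_sign A l else 0) else 0)"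
    unfolding Ad_nth signed_perm_def
    by (intro sum.cong refl) (auto intro!: sum.cong simp del: sum.delta sum.delta')
  then show ?thesis
    by (simp add: subset_sign_def)
qed

lemma unitary_signed_perm:
  assumes "bij p"
  shows "unitary (signed_perm A p)"
proof -
  have "(cadj (signed_perm A p) ** signed_perm A p) $ i $ j = (if i = j then 1 else 0)" for i j
  proof -
    have "(cadj (signed_perm A p) ** signed_perm A p) $ i $ j
      = (\<Sum>a\<in>UNIV. if a = p j then (if p i = p j then cnj (subset_sign A i) * subset_sign A j else 0) else 0)"
      by (auto simp: matrix_matrix_mult_def signed_perm_def intro!: sum.cong sum.neutral simp del: sum.delta sum.delta')
    also have "\<dots> = (if i = j then 1 else 0)"
      using bij_is_inj[OF assms] by (auto simp: subset_sign_def inj_eq)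
    finally show ?thesis .
  qed
  then show ?thesis
    by (simp add: unitary_def vec_eq_iff mat_def)
qed

text \<open>The signed permutation matrices form a unitary 1-design: their average replaces an
  integral over the Haar measure.\<close>
lemma depolarizing_in_unitary_mix:
  obtains \<Omega> :: "'n::finite mat \<Rightarrow>\<^sub>L 'n mat"
  where "\<Omega> \<in> unitary_mix" and "\<And>X. blinfun_apply \<Omega> X = cscale (trace X / of_nat CARD('n)) (mat 1)"
proof
  let ?P = "{p::'n \<Rightarrow> 'n. bij p}"
  let ?I = "(UNIV::'n set set) \<times> ?P"
  define N where "N = card ?I"
  have "id \<in> ?P" by simp
  then have P: "card ?P > 0"
    by (metis card_gt_0_iff empty_iff finite)
  have N_eq: "N = 2 ^ CARD('n) * card ?P"
    by (simp add: N_def card_cartesian_product card_Pow flip: Pow_UNIV)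
  then have N: "N > 0" using P by simp
  define \<Omega> where "\<Omega> = (\<Sum>(A, p)\<in>?I. (1 / real N) *\<^sub>R Ad (signed_perm A p))"
  have "(\<Sum>x\<in>?I. (1 / real N) *\<^sub>R (case x of (A, p) \<Rightarrow> Ad (signed_perm A p))) \<in> unitary_mix"
    by (rule convex_sum)
      (use N in \<open>auto simp: N_def[symmetric] convex_unitary_mix intro!: Ad_in_unitary_mix unitary_signed_perm\<close>)
  then show "\<Omega> \<in> unitary_mix"
    by (simp add: \<Omega>_def case_prod_unfold)
  show "blinfun_apply \<Omega> X = cscale (trace X / of_nat CARD('n)) (mat 1)" for X
  proof -
    have "blinfun_apply \<Omega> X $ k $ l = (trace X / of_nat CARD('n)) * (if k = l then 1 else 0)" for k l
    proof -
      have "of_nat N * blinfun_apply \<Omega> X $ k $ l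
          = (\<Sum>(A, p)\<in>?I. subset_sign A k * subset_sign A l * X $ p k $ p l)"
        using N by (simp add: \<Omega>_def blinfun.sum_left case_prod_unfold blinfun.scaleR_left Ad_signed_perm_nth
            sum_distrib_left scaleR_conv_of_real[where 'a = complex])
      also have "\<dots> = (\<Sum>A\<in>UNIV. \<Sum>p\<in>?P. subset_sign A k * subset_sign A l * X $ p k $ p l)"
        by (rule sum.cartesian_product[symmetric])
      also have "\<dots> = (\<Sum>A\<in>UNIV. subset_sign A k * subset_sign A l) * (\<Sum>p\<in>?P. X $ p k $ p l)"
        by (simp add: sum_product)
      \<comment> \<open>The signs remove the off-diagonal entries; the permutations then replace
        each diagonal entry by the mean of the diagonal.\<close>
      also have "\<dots> = (if k = l then 2 ^ CARD('n) * (\<Sum>p\<in>?P. X $ p k $ p k) else 0)"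
        by (simp add: sum_subset_sign)
      also have "(\<Sum>p\<in>?P. X $ p k $ p k) = of_nat (card ?P) * trace X / of_nat CARD('n)"
        using sum_bij_apply[of "\<lambda>a. X $ a $ a" k] by (simp add: trace_def field_simps)
      also have "(if k = l then 2 ^ CARD('n) * (of_nat (card ?P) * trace X / of_nat CARD('n)) else 0)
          = of_nat N * ((trace X / of_nat CARD('n)) * (if k = l then 1 else 0))"
        by (simp add: N_eq)
      finally show ?thesis
        using N by (auto simp only: mult_cancel_left of_nat_eq_0_iff)
    qed
    then show ?thesis
      by (simp add: vec_eq_iff mat_def)
  qed
qed

text \<open>Matrix units off the diagonal have trace zero, the others trace one. Pairing with
  \<open>\<Omega>\<close> thus amounts to taking the trace of the Choi matrix, up to the factor, and
  that trace vanishes on \<open>Wset_direction\<close>.\<close>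

lemma choi_depolarizing:
  fixes \<Omega> :: "'n::finite mat \<Rightarrow>\<^sub>L 'n mat"
  assumes "\<And>X. blinfun_apply \<Omega> X = cscale (trace X / of_nat CARD('n)) (mat 1)"
  shows "choi \<Omega> = (1 / (real CARD('n))\<^sup>2) *\<^sub>R mat 1"
proof -
  have "trace (munit i j :: 'n mat) = (if i = j then 1 else 0)" for i j
    by (auto simp: trace_def if_distrib sum.delta cong: if_cong conj_cong)
  then show ?thesis
    by (auto simp: vec_eq_iff choi_def assms mat_def prod_eq_iff power2_eq_square scaleR_conv_of_real[where 'a = complex])
qed

section \<open>Pairings with the identity map\<close>

lemma sum_UNIV_prod: "(\<Sum>p\<in>UNIV. f p) = (\<Sum>i\<in>UNIV. \<Sum>k\<in>UNIV. f (i, k))"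
  by (simp add: sum.cartesian_product case_prod_unfold flip: UNIV_Times_UNIV)

lemma trace_choi: "trace (choi \<Phi>) = (\<Sum>i\<in>UNIV. trace (blinfun_apply \<Phi> (munit i i))) / of_nat CARD('n)"
  for \<Phi> :: "'n::finite mat \<Rightarrow>\<^sub>L 'n mat"
  by (simp add: trace_def choi_nth sum_divide_distrib sum_UNIV_prod)

lemma inner_mat_1: "mat 1 \<bullet> Y = Re (trace Y)" for Y :: "complex^'m::finite^'m"
proof -
  have "cadj2 (mat 1 :: complex^'m^'m) = mat 1"
    by (simp add: vec_eq_iff cadj2_def mat_def)
  then show ?thesis by (simp add: inner_eq_trace_cadj2)
qed

text \<open>The Choi matrix of the identity is supported on the positions
  \<open>(i, i), (j, j)\<close>, with the value \<open>1 / CARD('n)\<close> there.\<close>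

lemma inner_choi_id:
  "choi id_blinfun \<bullet> choi \<Phi> = (\<Sum>i\<in>UNIV. \<Sum>j\<in>UNIV. Re (blinfun_apply \<Phi> (munit i j) $ i $ j)) / (real CARD('n))\<^sup>2"
  for \<Phi> :: "'n::finite mat \<Rightarrow>\<^sub>L 'n mat"
proof -
  let ?d = "real CARD('n)"
  have "choi id_blinfun \<bullet> choi \<Phi> = (\<Sum>i\<in>UNIV. \<Sum>k\<in>UNIV. \<Sum>j\<in>UNIV. \<Sum>l\<in>UNIV.
      choi id_blinfun $ (i, k) $ (j, l) \<bullet> choi \<Phi> $ (i, k) $ (j, l))"
    by (simp add: inner_vec_def sum_UNIV_prod)
  also have "\<dots> = (\<Sum>i\<in>UNIV. \<Sum>k\<in>UNIV. if k = i then \<Sum>j\<in>UNIV. \<Sum>l\<in>UNIV. if l = j then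
      Re (blinfun_apply \<Phi> (munit i j) $ k $ l) / ?d\<^sup>2 else 0 else 0)"
    by (intro sum.cong refl) (auto simp: choi_nth inner_complex_def power2_eq_square intro!: sum.cong sum.neutral simp del: sum.delta sum.delta')
  also have "\<dots> = (\<Sum>i\<in>UNIV. \<Sum>j\<in>UNIV. Re (blinfun_apply \<Phi> (munit i j) $ i $ j)) / ?d\<^sup>2"
    by (simp add: sum_divide_distrib)
  finally show ?thesis .
qed

lemma inner_choi_id_id: "choi id_blinfun \<bullet> choi (id_blinfun :: 'n::finite mat \<Rightarrow>\<^sub>L 'n mat) = 1"
  by (simp add: inner_choi_id power2_eq_square)

text \<open>The pairing is the squared modulus of \<open>trace U\<close> divided by the squared
  dimension. Each summand is the real part of \<open>cnj (U $ i $ i) * U $ j $ j\<close>, and these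
  entries have modulus at most one because the columns of \<open>U\<close> are unit vectors.\<close>

lemma inner_choi_id_Ad_le:
  fixes U :: "'n::finite mat"
  assumes "unitary U"
  shows "choi id_blinfun \<bullet> choi (Ad U) \<le> 1"
proof -
  have diag: "norm (U $ j $ j) \<le> 1" for j
  proof -
    have "complex_of_real (\<Sum>a\<in>UNIV. (norm (U $ a $ j))\<^sup>2) = (\<Sum>a\<in>UNIV. cnj (U $ a $ j) * U $ a $ j)"
      unfolding of_real_sum by (intro sum.cong refl) (metis complex_norm_square mult.commute)
    also have "\<dots> = (cadj U ** U) $ j $ j"
      by (simp add: matrix_matrix_mult_def)
    also have "\<dots> = complex_of_real 1"
      using assms by (simp add: unitary_def mat_def)
    finally have "(\<Sum>a\<in>UNIV. (norm (U $ a $ j))\<^sup>2) = 1"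
      by (simp only: of_real_eq_iff)
    moreover have "(norm (U $ j $ j))\<^sup>2 \<le> (\<Sum>a\<in>UNIV. (norm (U $ a $ j))\<^sup>2)"
      by (rule member_le_sum) auto
    ultimately show ?thesis
      using power2_le_imp_le[of "norm (U $ j $ j)" 1] by simp
  qed
  have "Re (blinfun_apply (Ad U) (munit i j) $ i $ j) \<le> 1" for i j
  proof -
    have "blinfun_apply (Ad U) (munit i j) $ i $ j
        = (\<Sum>b\<in>UNIV. if b = j then \<Sum>a\<in>UNIV. if a = i then cnj (U $ i $ i) * U $ j $ j else 0 else 0)"
      unfolding Ad_nth
      by (intro sum.cong refl) (auto intro!: sum.cong sum.neutral simp del: sum.delta sum.delta')
    then have "norm (blinfun_apply (Ad U) (munit i j) $ i $ j) = norm (U $ i $ i) * norm (U $ j $ j)"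
      by (simp add: norm_mult)
    also have "\<dots> \<le> 1"
      by (intro mult_le_one diag) simp
    finally show ?thesis
      using complex_Re_le_cmod order_trans by blast
  qed
  then have "(\<Sum>i\<in>UNIV. \<Sum>j\<in>UNIV. Re (blinfun_apply (Ad U) (munit i j) $ i $ j)) \<le> (\<Sum>i\<in>(UNIV::'n set). \<Sum>j\<in>(UNIV::'n set). 1)"
    by (intro sum_mono)
  then show ?thesis
    by (simp add: inner_choi_id power2_eq_square divide_le_eq)
qed

section \<open>The cone of generators\<close>

lemma convex_cone_unitary_cone: "convex_cone unitary_cone"
  and closed_unitary_cone: "closed unitary_cone"
proof -
  have "convex_cone (unitary_cone :: ('n::finite mat \<Rightarrow>\<^sub>L 'n mat) set) \<and> closed (unitary_cone :: ('n mat \<Rightarrow>\<^sub>L 'n mat) set)"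
    unfolding unitary_cone_def by (rule hull_in) (auto intro!: convex_cone_Inter closed_Inter)
  then show "convex_cone (unitary_cone :: ('n::finite mat \<Rightarrow>\<^sub>L 'n mat) set)" "closed (unitary_cone :: ('n mat \<Rightarrow>\<^sub>L 'n mat) set)"
    by blast+
qed

lemma unitary_cone_subset:
  assumes "convex_cone S" "closed S" "\<And>U. unitary U \<Longrightarrow> Ad U - id_blinfun \<in> S"
  shows "unitary_cone \<subseteq> S"
  unfolding unitary_cone_def by (rule hull_minimal) (use assms in auto)

lemma Ad_diff_id_in_unitary_cone: "unitary U \<Longrightarrow> Ad U - id_blinfun \<in> unitary_cone"
  unfolding unitary_cone_def by (rule hull_inc) auto

lemma unitary_mix_diff_id_in_unitary_cone: "m \<in> unitary_mix \<Longrightarrow> m - id_blinfun \<in> unitary_cone"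
  by (rule unitary_mix_diff_id)
    (use convex_cone_unitary_cone Ad_diff_id_in_unitary_cone in \<open>auto simp: convex_cone_def\<close>)

section \<open>Passage between the semigroup and the cone\<close>

lemma unitary_cone_of_mixed_unitary:
  assumes "\<And>t. t \<ge> 0 \<Longrightarrow> mixed_unitary (map_exp t L)"
  shows "L \<in> unitary_cone"
proof -
  have "\<exists>m\<in>unitary_mix. map_exp (1 / real (Suc n)) L = blinfun_apply m" for n
    using assms[of "1 / real (Suc n)"] by (simp add: mixed_unitary_iff del: of_nat_Suc)
  then obtain m where m: "\<And>n. m n \<in> unitary_mix" "\<And>n. map_exp (1 / real (Suc n)) L = blinfun_apply (m n)"
    by metis
  have "real (Suc n) *\<^sub>R (m n - id_blinfun) \<in> unitary_cone" for n
    by (intro convex_cone_scaleR[OF convex_cone_unitary_cone] unitary_mix_diff_id_in_unitary_cone m) simp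
  \<comment> \<open>In finite dimension, pointwise convergence of linear maps is convergence in
    norm.\<close>
  moreover have "(\<lambda>n. real (Suc n) *\<^sub>R (m n - id_blinfun)) \<longlonglongrightarrow> L"
    by (rule tendsto_componentwise1)
      (use map_exp_derivative_at_0[of L] in \<open>simp only: m(2) blinfun.scaleR_left blinfun.diff_left blinfun_apply_id_blinfun id_apply\<close>)
  ultimately show ?thesis
    by (rule closed_sequentially[OF closed_unitary_cone])
qed

lemma unitary_mix_funpow:
  assumes "m \<in> unitary_mix"
  shows "\<exists>q\<in>unitary_mix. blinfun_apply q = blinfun_apply m ^^ n"
proof (induction n)
  case 0
  then show ?case
    by (intro bexI[OF _ id_in_unitary_mix]) (simp add: fun_eq_iff)
next
  case (Suc n)
  then obtain q where "q \<in> unitary_mix" "blinfun_apply q = blinfun_apply m ^^ n" by blast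
  then show ?case
    by (intro bexI[of _ "m o\<^sub>L q"]) (simp_all add: unitary_mix_compose assms fun_eq_iff)
qed

lemma convex_cone_closure:
  fixes S :: "'a::real_normed_vector set"
  assumes "convex_cone S"
  shows "convex_cone (closure S)"
  unfolding convex_cone_iff
proof (intro conjI ballI allI impI)
  show "0 \<in> closure S"
    using convex_cone_contains_0[OF assms] closure_subset by blast
  show "x + y \<in> closure S" if x: "x \<in> closure S" and y: "y \<in> closure S" for x y
  proof -
    obtain f where "\<And>n. f n \<in> S" "f \<longlonglongrightarrow> x"
      using x unfolding closure_sequential by blast
    moreover obtain g where "\<And>n. g n \<in> S" "g \<longlonglongrightarrow> y"
      using y unfolding closure_sequential by blast
    ultimately show ?thesis
      unfolding closure_sequential
      by (intro exI[of _ "\<lambda>n. f n + g n"]) (auto intro: tendsto_add convex_cone_add[OF assms])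
  qed
  show "c *\<^sub>R x \<in> closure S" if x: "x \<in> closure S" and c: "0 \<le> c" for x c
  proof -
    obtain f where "\<And>n. f n \<in> S" "f \<longlonglongrightarrow> x"
      using x unfolding closure_sequential by blast
    then show ?thesis
      unfolding closure_sequential using c
      by (intro exI[of _ "\<lambda>n. c *\<^sub>R f n"]) (auto intro: tendsto_scaleR convex_cone_scaleR[OF assms])
  qed
qed

text \<open>The multiples \<open>c *\<^sub>R (m - id_blinfun)\<close> already form a convex cone,
  because a sum of two of them is again one with a weighted mean of the two channels. The closure of
  this cone contains the generators, hence \<open>unitary_cone\<close>.\<close>

lemma unitary_cone_approx:
  fixes L :: "'n::finite mat \<Rightarrow>\<^sub>L 'n mat"
  assumes "L \<in> unitary_cone"
  obtains c m where "\<And>n. 0 \<le> c n" "\<And>n. m n \<in> unitary_mix" "(\<lambda>n. c n *\<^sub>R (m n - id_blinfun)) \<longlonglongrightarrow> L"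
proof -
  define S where "S = {c *\<^sub>R (m - id_blinfun) | c m. 0 \<le> c \<and> m \<in> (unitary_mix :: ('n mat \<Rightarrow>\<^sub>L 'n mat) set)}"
  have S: "c *\<^sub>R (m - id_blinfun) \<in> S" if "0 \<le> c" "m \<in> unitary_mix" for c m
    using that unfolding S_def by blast
  have "convex_cone S"
    unfolding convex_cone_iff
  proof (intro conjI ballI allI impI)
    show "0 \<in> S"
      using S[OF order_refl id_in_unitary_mix] by simp
    show "a *\<^sub>R x \<in> S" if x: "x \<in> S" and a: "0 \<le> a" for x a
    proof -
      obtain c m where "0 \<le> c" "m \<in> unitary_mix" "x = c *\<^sub>R (m - id_blinfun)"
        using x unfolding S_def by blast
      then show ?thesis using S[of "a * c" m] a by simp
    qed
    show "x + y \<in> S" if x: "x \<in> S" and y: "y \<in> S" for x y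
    proof -
      obtain c m where c: "0 \<le> c" "m \<in> unitary_mix" "x = c *\<^sub>R (m - id_blinfun)"
        using x unfolding S_def by blast
      obtain c' m' where c': "0 \<le> c'" "m' \<in> unitary_mix" "y = c' *\<^sub>R (m' - id_blinfun)"
        using y unfolding S_def by blast
      show ?thesis
      \<comment> \<open>The weights of the mean have denominator \<open>c + c'\<close>; if it is
        zero, both summands vanish.\<close>
      proof (cases "c + c' = 0")
        case True
        then have "c = 0" "c' = 0" using c(1) c'(1) by auto
        then show ?thesis using c(3) c'(3) \<open>0 \<in> S\<close> by simp
      next
        case False
        define q where "q = (c / (c + c')) *\<^sub>R m + (c' / (c + c')) *\<^sub>R m'"
        have "q \<in> unitary_mix"
          unfolding q_def
          by (rule convexD[OF convex_unitary_mix c(2) c'(2)])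
            (use False c(1) c'(1) in \<open>auto simp: add_divide_distrib[symmetric]\<close>)
        moreover have "(c + c') *\<^sub>R (q - id_blinfun) = x + y"
          using False by (simp add: q_def c(3) c'(3) scaleR_add_right scaleR_diff_right scaleR_add_left)
        ultimately show ?thesis
          using S[of "c + c'" q] c(1) c'(1) by simp
      qed
    qed
  qed
  moreover have "Ad U - id_blinfun \<in> closure S" if "unitary U" for U
    using S[of 1 "Ad U"] that closure_subset by (auto simp: Ad_in_unitary_mix)
  ultimately have "unitary_cone \<subseteq> closure S"
    by (intro unitary_cone_subset convex_cone_closure closed_closure)
  then obtain f where f: "\<And>n. f n \<in> S" "f \<longlonglongrightarrow> L"
    using assms unfolding closure_sequential subset_iff by blast
  have "\<exists>c m. 0 \<le> c \<and> m \<in> unitary_mix \<and> f n = c *\<^sub>R (m - id_blinfun)" for n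
    using f(1)[of n] unfolding S_def by blast
  then obtain c m where cm: "\<And>n. 0 \<le> c n \<and> m n \<in> unitary_mix \<and> f n = c n *\<^sub>R (m n - id_blinfun)"
    by metis
  then have "f = (\<lambda>n. c n *\<^sub>R (m n - id_blinfun))"
    by auto
  with f(2) cm that show ?thesis by blast
qed

lemma mixed_unitary_of_unitary_cone:
  assumes "L \<in> unitary_cone" "t \<ge> 0"
  shows "mixed_unitary (map_exp t L)"
proof -
  obtain c m where c: "\<And>n. 0 \<le> c n" and m: "\<And>n. m n \<in> unitary_mix"
    and lim: "(\<lambda>n. c n *\<^sub>R (m n - id_blinfun)) \<longlonglongrightarrow> L"
    by (rule unitary_cone_approx[OF assms(1)]) (rule that)
  \<comment> \<open>The ceiling keeps \<open>t * c n / N n\<close> at most 1, the summand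
    \<open>n\<close> drives \<open>N\<close> to infinity, and \<open>Suc\<close> keeps it
    positive.\<close>
  define N where "N n = Suc (n + nat \<lceil>t * c n\<rceil>)" for n
  have N: "filterlim N at_top sequentially"
    by (rule filterlim_at_top_mono[OF filterlim_ident]) (auto simp: N_def)
  define s where "s n = t * c n / real (N n)" for n
  have s: "0 \<le> s n" "s n \<le> 1" for n
  proof -
    have "t * c n \<le> real (N n)"
      unfolding N_def by linarith
    moreover have "0 \<le> t * c n" "N n > 0"
      using assms(2) c by (simp_all add: N_def)
    ultimately show "0 \<le> s n" "s n \<le> 1"
      by (auto simp: s_def)
  qed
  have step: "id_blinfun + (t / real (N n)) *\<^sub>R (c n *\<^sub>R (m n - id_blinfun)) \<in> unitary_mix" for n
  proof -
    have "(1 - s n) *\<^sub>R id_blinfun + s n *\<^sub>R m n \<in> unitary_mix"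
      using s by (intro convexD_alt convex_unitary_mix id_in_unitary_mix m)
    also have "(1 - s n) *\<^sub>R id_blinfun + s n *\<^sub>R m n
        = id_blinfun + (t / real (N n)) *\<^sub>R (c n *\<^sub>R (m n - id_blinfun))"
      by (simp add: s_def scaleR_diff_left scaleR_diff_right)
    finally show ?thesis .
  qed
  have "\<exists>q\<in>unitary_mix. blinfun_apply q
      = blinfun_apply (id_blinfun + (t / real (N n)) *\<^sub>R (c n *\<^sub>R (m n - id_blinfun))) ^^ N n" for n
    by (rule unitary_mix_funpow[OF step])
  then obtain q where q: "\<And>n. q n \<in> unitary_mix"
    "\<And>n. blinfun_apply (q n) = blinfun_apply (id_blinfun + (t / real (N n)) *\<^sub>R (c n *\<^sub>R (m n - id_blinfun))) ^^ N n"
    by metis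
  \<comment> \<open>The powers are so far known to converge only pointwise; compactness supplies a
    limit inside the hull, which must agree with \<open>map_exp t L\<close>.\<close>
  have "seq_compact (unitary_mix :: ('a mat \<Rightarrow>\<^sub>L 'a mat) set)"
    using compact_unitary_mix by (simp add: compact_eq_seq_compact_metric)
  then obtain l r where l: "l \<in> unitary_mix" and r: "strict_mono (r :: nat \<Rightarrow> nat)" and ql: "(q \<circ> r) \<longlonglongrightarrow> l"
    using seq_compactE q(1) by metis
  have "map_exp t L X = blinfun_apply l X" for X
  proof (rule LIMSEQ_unique)
    have "(\<lambda>n. blinfun_apply (q n) X) \<longlonglongrightarrow> map_exp t L X"
      unfolding q(2) by (rule tendsto_map_exp[OF lim N])
    then show "(\<lambda>n. blinfun_apply (q (r n)) X) \<longlonglongrightarrow> map_exp t L X"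
      using LIMSEQ_subseq_LIMSEQ[OF _ r] by (auto simp: comp_def)
    show "(\<lambda>n. blinfun_apply (q (r n)) X) \<longlonglongrightarrow> blinfun_apply l X"
      using ql by (auto simp: comp_def intro: tendsto_intros)
  qed
  then show ?thesis
    unfolding mixed_unitary_iff using l by blast
qed

section \<open>Duality between the cone and \<open>Dset\<close>\<close>

lemma Dset_nonneg_on_unitary_cone:
  assumes "\<Gamma> \<in> Dset" "L \<in> unitary_cone"
  shows "Re (hs_inner \<Gamma> L) \<ge> 0"
proof -
  \<comment> \<open>A closed half-space through zero; it contains the generators because
    \<open>\<Gamma>\<close> is orthogonal to the identity.\<close>
  let ?H = "{\<Phi>. 0 \<le> choi \<Gamma> \<bullet> choi \<Phi>}"
  have "convex_cone ?H"
    by (simp add: convex_cone_iff linear_0[OF linear_choi] linear_add[OF linear_choi]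
        linear_scale[OF linear_choi] inner_add_right)
  moreover have "closed ?H"
    by (intro closed_Collect_le continuous_intros continuous_on_choi)
  moreover have "Ad U - id_blinfun \<in> ?H" if "unitary U" for U
  proof -
    have "Re (hs_inner id_blinfun \<Gamma>) = 0" "Re (hs_inner (Ad U) \<Gamma>) \<ge> 0"
      using assms(1) that by (auto simp: Dset_def)
    then show ?thesis
      by (simp add: Re_hs_inner linear_diff[OF linear_choi] inner_diff_left inner_commute[of "choi \<Gamma>"])
  qed
  ultimately have "unitary_cone \<subseteq> ?H"
    by (rule unitary_cone_subset)
  then show ?thesis
    using assms(2) by (auto simp: Re_hs_inner)
qed

lemma unitary_cone_of_Dset_nonneg:
  fixes L :: "'n::finite mat \<Rightarrow>\<^sub>L 'n mat"
  assumes L: "L \<in> Wset_direction" and nonneg: "\<And>\<Gamma>. \<Gamma> \<in> Dset \<Longrightarrow> Re (hs_inner \<Gamma> L) \<ge> 0"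
  shows "L \<in> unitary_cone"
proof (rule ccontr)
  assume notin: "L \<notin> unitary_cone"
  note [simp] = linear_add[OF linear_choi] linear_diff[OF linear_choi] linear_scale[OF linear_choi]
  let ?d = "real CARD('n)"
  let ?W = "Wset_direction :: ('n mat \<Rightarrow>\<^sub>L 'n mat) set"
  have herm: "herm_pres \<Phi>" if "\<Phi> \<in> ?W" for \<Phi>
    using that by (simp add: Wset_direction_def)
  \<comment> \<open>The cone is pulled back to the Euclidean matrix space so that a hyperplane can
    be separated off there.\<close>
  let ?S = "unchoi -` (unitary_cone :: ('n mat \<Rightarrow>\<^sub>L 'n mat) set)"
  have cone: "convex_cone ?S"
    using convex_cone_unitary_cone
    by (auto simp: convex_cone_iff linear_0[OF linear_unchoi] linear_add[OF linear_unchoi] linear_scale[OF linear_unchoi])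
  have "closed ?S"
    by (intro closed_vimage closed_unitary_cone linear_continuous_on linear_unchoi[unfolded linear_conv_bounded_linear])
  moreover have "choi L \<notin> ?S"
    using notin by (simp add: unchoi_choi herm L)
  ultimately obtain a b where ab: "a \<bullet> choi L < b" "\<And>x. x \<in> ?S \<Longrightarrow> b < a \<bullet> x"
    using separating_hyperplane_closed_point[of ?S "choi L"] cone unfolding convex_cone_def by blast
  have "b < 0"
    using ab(2)[OF convex_cone_contains_0[OF cone]] by simp
  then have a_neg: "a \<bullet> choi L < 0"
    using ab(1) by simp
  \<comment> \<open>A point of the cone with negative value could be rescaled to have the value
    \<open>b\<close> exactly, against the strict separation.\<close>
  have a_nonneg: "0 \<le> a \<bullet> x" if "x \<in> ?S" for x
  proof (rule ccontr)
    assume "\<not> 0 \<le> a \<bullet> x"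
    then have "0 \<le> b / (a \<bullet> x)"
      using \<open>b < 0\<close> by (simp add: divide_nonpos_nonpos)
    then have "b < a \<bullet> ((b / (a \<bullet> x)) *\<^sub>R x)"
      by (intro ab(2) convex_cone_scaleR[OF cone] that)
    with \<open>\<not> 0 \<le> a \<bullet> x\<close> show False by simp
  qed
  have subspace: "subspace (choi ` ?W)"
    by (intro linear_subspace_image linear_choi subspace_Wset_direction)
  \<comment> \<open>Orthogonal projection onto the Choi matrices of the direction space:
    \<open>a\<close> and its projection pair equally with all of that space.\<close>
  obtain y z where "y \<in> span (choi ` ?W)" and z: "\<And>w. w \<in> span (choi ` ?W) \<Longrightarrow> orthogonal z w" and "a = y + z"
    using orthogonal_subspace_decomp_exists[of "choi ` ?W" a] by blast
  then obtain \<Gamma>1 where \<Gamma>1: "\<Gamma>1 \<in> ?W" and "a = choi \<Gamma>1 + z"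
    by (auto simp: span_eq_iff[THEN iffD2, OF subspace])
  then have proj: "choi \<Gamma>1 \<bullet> choi \<Phi> = a \<bullet> choi \<Phi>" if "\<Phi> \<in> ?W" for \<Phi>
    using z[of "choi \<Phi>"] that by (simp add: inner_add_left orthogonal_def span_base)
  have \<Gamma>1_L: "choi \<Gamma>1 \<bullet> choi L < 0"
    using a_neg proj[OF L] by simp
  have \<Gamma>1_Ad: "choi \<Gamma>1 \<bullet> choi (Ad U - id_blinfun) \<ge> 0" if "unitary U" for U
  proof -
    have "choi (Ad U - id_blinfun) \<in> ?S"
      using Ad_diff_id_in_unitary_cone[OF that]
      by (simp only: vimage_eq unchoi_choi[OF herm[OF Ad_diff_id_in_Wset_direction[OF that]]])
    then show ?thesis
      using a_nonneg proj[OF Ad_diff_id_in_Wset_direction[OF that]] by simp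
  qed
  obtain \<Omega> :: "'n mat \<Rightarrow>\<^sub>L 'n mat" where \<Omega>: "\<Omega> \<in> unitary_mix"
    and \<Omega>_apply: "\<And>X. blinfun_apply \<Omega> X = cscale (trace X / of_nat CARD('n)) (mat 1)"
    using depolarizing_in_unitary_mix by blast
  have \<Omega>_inner: "choi \<Omega> \<bullet> Y = Re (trace Y) / ?d\<^sup>2" for Y
    by (simp add: choi_depolarizing[OF \<Omega>_apply] inner_mat_1)
  have \<Omega>_W: "choi \<Omega> \<bullet> choi \<Phi> = 0" if "\<Phi> \<in> ?W" for \<Phi>
    using that by (simp add: \<Omega>_inner trace_choi Wset_direction_def)
  have "trace (munit i i :: 'n mat) = 1" for i
    by (auto simp: trace_def if_distrib sum.delta cong: if_cong conj_cong)
  then have \<Omega>_id: "choi \<Omega> \<bullet> choi id_blinfun = 1 / ?d\<^sup>2"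
    by (simp add: \<Omega>_inner trace_choi)
  have mix_W: "m - id_blinfun \<in> ?W" if "m \<in> unitary_mix" for m
    by (rule unitary_mix_diff_id[OF subspace_imp_convex[OF subspace_Wset_direction] Ad_diff_id_in_Wset_direction that])
  have "convex {\<Phi>. 0 \<le> choi \<Gamma>1 \<bullet> choi \<Phi>}"
    by (auto simp: convex_def inner_add_right)
  then have "\<Omega> - id_blinfun \<in> {\<Phi>. 0 \<le> choi \<Gamma>1 \<bullet> choi \<Phi>}"
    by (rule unitary_mix_diff_id[OF _ _ \<Omega>]) (rule CollectI, rule \<Gamma>1_Ad)
  then have \<Gamma>1_id: "choi \<Gamma>1 \<bullet> choi id_blinfun \<le> 0"
    using \<Omega>_W[OF \<Gamma>1] by (simp add: inner_diff_right inner_commute)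
  \<comment> \<open>In dimension one the trace condition forces \<open>L = 0\<close>, which cannot
    be separated. The strict bound gives \<open>1 / ?d\<^sup>2 < 1\<close> below.\<close>
  have d: "?d > 1"
  proof (rule ccontr)
    assume "\<not> ?d > 1"
    then have "CARD('n) = 1"
      using zero_less_card_finite[where 'a = 'n] by linarith
    then obtain e where e: "(UNIV :: 'n set) = {e}"
      using card_1_singletonE by blast
    then have all_e: "i = e" for i :: 'n
      by blast
    have "blinfun_apply L X $ e $ e = 0" for X
      using L by (simp add: Wset_direction_def trace_def e)
    then have "blinfun_apply L X $ i $ j = 0" for X i j
      using all_e[of i] all_e[of j] by simp
    then have "L = 0"
      by (intro blinfun_eqI) (simp add: vec_eq_iff)
    with \<Gamma>1_L show False
      by (simp add: linear_0[OF linear_choi])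
  qed
  \<comment> \<open>Small enough that the perturbation uses up at most half of the negative value at
    \<open>L\<close>; the added 1 keeps the denominator positive.\<close>
  define \<epsilon> where "\<epsilon> = - (choi \<Gamma>1 \<bullet> choi L) / (2 * (\<bar>choi (\<Omega> - id_blinfun) \<bullet> choi L\<bar> + 1))"
  have \<epsilon>: "\<epsilon> > 0"
    using \<Gamma>1_L by (simp add: \<epsilon>_def divide_neg_pos)
  define \<Gamma>2 where "\<Gamma>2 = \<Gamma>1 + \<epsilon> *\<^sub>R (\<Omega> - id_blinfun)"
  have \<Gamma>2_W: "\<Gamma>2 \<in> ?W"
    unfolding \<Gamma>2_def
    by (intro subspace_add[OF subspace_Wset_direction] subspace_scale[OF subspace_Wset_direction] \<Gamma>1 mix_W \<Omega>)
  have \<Gamma>2_L: "choi \<Gamma>2 \<bullet> choi L < 0"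
  proof -
    let ?x = "choi (\<Omega> - id_blinfun) \<bullet> choi L"
    have "\<epsilon> * ?x \<le> \<epsilon> * (\<bar>?x\<bar> + 1)"
      using \<epsilon> by (intro mult_left_mono) auto
    also have "\<dots> = - (choi \<Gamma>1 \<bullet> choi L) / 2"
      by (simp add: \<epsilon>_def field_simps)
    finally show ?thesis
      using \<Gamma>1_L by (simp add: \<Gamma>2_def inner_add_left del: linear_diff[OF linear_choi])
  qed
  have \<Gamma>2_Ad: "choi \<Gamma>2 \<bullet> choi (Ad U - id_blinfun) \<ge> 0" if "unitary U" for U
  proof -
    \<comment> \<open>By orthogonality of \<open>\<Omega>\<close> to the direction space, the
      pairing equals one minus that of the identity with \<open>Ad U\<close>.\<close>
    have "choi (\<Omega> - id_blinfun) \<bullet> choi (Ad U - id_blinfun) \<ge> 0"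
      using \<Omega>_W[OF Ad_diff_id_in_Wset_direction[OF that]] inner_choi_id_Ad_le[OF that]
        inner_choi_id_id[where 'n = 'n]
      by (simp add: inner_diff_left inner_diff_right)
    then show ?thesis
      using \<Gamma>1_Ad[OF that] \<epsilon> by (simp add: \<Gamma>2_def inner_add_left del: linear_diff[OF linear_choi])
  qed
  have \<Gamma>2_id: "choi \<Gamma>2 \<bullet> choi id_blinfun < 0"
  proof -
    have "1 / ?d\<^sup>2 < 1"
      using d by (simp add: divide_less_eq one_less_power)
    then have "\<epsilon> * (1 / ?d\<^sup>2 - 1) < 0"
      using \<epsilon> by (intro mult_pos_neg) auto
    then show ?thesis
      using \<Gamma>1_id by (simp add: \<Gamma>2_def inner_add_left inner_diff_left \<Omega>_id inner_choi_id_id)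
  qed
  \<comment> \<open>Solves \<open>1 / ?d\<^sup>2 + r * (choi \<Gamma>2 \<bullet> choi id_blinfun) =
    0\<close>, the condition that \<open>\<Gamma>\<close> be orthogonal to the identity.\<close>
  define r where "r = - 1 / (?d\<^sup>2 * (choi \<Gamma>2 \<bullet> choi id_blinfun))"
  have r: "r > 0"
    using \<Gamma>2_id d by (simp add: r_def divide_neg_neg mult_pos_neg)
  define \<Gamma> where "\<Gamma> = \<Omega> + r *\<^sub>R \<Gamma>2"
  have \<Gamma>_W: "\<Gamma> - id_blinfun \<in> ?W"
  proof -
    have "(\<Omega> - id_blinfun) + r *\<^sub>R \<Gamma>2 \<in> ?W"
      by (intro subspace_add[OF subspace_Wset_direction] subspace_scale[OF subspace_Wset_direction] \<Gamma>2_W mix_W \<Omega>)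
    then show ?thesis by (simp add: \<Gamma>_def algebra_simps)
  qed
  have herm_\<Gamma>: "herm_pres \<Gamma>"
    using herm_pres_add[OF herm[OF \<Gamma>_W] herm_pres_id] by simp
  have \<Gamma>_id: "choi id_blinfun \<bullet> choi \<Gamma> = 0"
    using \<Gamma>2_id d by (simp add: \<Gamma>_def inner_diff_left \<Omega>_id inner_commute[of "choi id_blinfun"] r_def)
  have "\<Gamma> \<in> Dset"
    unfolding Dset_def Wset_def
  proof (intro CollectI conjI allI impI)
    show "herm_pres \<Gamma>" by (rule herm_\<Gamma>)
    show "blinfun_apply \<Gamma> (mat 1) = mat 1"
      using \<Gamma>_W by (simp add: Wset_direction_def blinfun.diff_left)
    show "trace (blinfun_apply \<Gamma> X) = trace X" for X
      using \<Gamma>_W by (simp add: Wset_direction_def blinfun.diff_left trace_sub)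
    show "hs_inner id_blinfun \<Gamma> = 0"
      by (simp add: complex_eq_iff Re_hs_inner \<Gamma>_id Im_hs_inner herm_\<Gamma> herm_pres_id)
    show "0 \<le> Re (hs_inner (Ad U) \<Gamma>)" if "unitary U" for U
    proof -
      \<comment> \<open>Orthogonality of \<open>\<Gamma>\<close> to the identity allows subtracting
        it; then \<open>\<Omega>\<close> drops out, being orthogonal to the direction space.\<close>
      have "choi (Ad U) \<bullet> choi \<Gamma> = choi (Ad U - id_blinfun) \<bullet> choi \<Gamma>"
        by (simp add: inner_diff_left \<Gamma>_id)
      also have "\<dots> = r * (choi \<Gamma>2 \<bullet> choi (Ad U - id_blinfun))"
        using \<Omega>_W[OF Ad_diff_id_in_Wset_direction[OF that]]
        by (simp add: \<Gamma>_def inner_add_right inner_commute del: linear_diff[OF linear_choi])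
      finally show ?thesis
        using r \<Gamma>2_Ad[OF that] by (simp add: Re_hs_inner)
    qed
  qed
  then have "0 \<le> choi \<Gamma> \<bullet> choi L"
    using nonneg by (simp flip: Re_hs_inner)
  also have "\<dots> = r * (choi \<Gamma>2 \<bullet> choi L)"
    by (simp add: \<Gamma>_def inner_add_left \<Omega>_W[OF L])
  finally show False
    using r \<Gamma>2_L by (simp add: zero_le_mult_iff)
qed

theorem theorem5p2:
  fixes L :: "('n::finite mat) \<Rightarrow>\<^sub>L ('n mat)"
  assumes "herm_pres L"
    and "blinfun_apply L (mat 1) = 0"
    and "\<forall>X. trace (blinfun_apply L X) = 0"
  shows "((\<forall>t\<ge>0. mixed_unitary (map_exp t L)) \<longleftrightarrow> L \<in> unitary_cone)
       \<and> (L \<in> unitary_cone \<longleftrightarrow> (\<forall>\<Gamma>\<in>Dset. Re (hs_inner \<Gamma> L) \<ge> 0))"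
proof -
  have "L \<in> Wset_direction"
    using assms by (simp add: Wset_direction_def)
  then show ?thesis
    using unitary_cone_of_mixed_unitary mixed_unitary_of_unitary_cone
      Dset_nonneg_on_unitary_cone unitary_cone_of_Dset_nonneg by blast
qed

end
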